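(* Let $N, L, n$ be integers with $1 \le n \le N$, $n - 1 \le N/2$ and $L \in \{0,1,\ldots,N\}$. Then \[ \rho \bigl( \mathrm{Hyp}(N,L,n), \mathrm{Bin}(n,L/N) \bigr) \ \le \ \rho \bigl( \mathrm{Hyp}(N,1,n), \mathrm{Bin}(n,1/N) \bigr) \ = \ \Bigl( 1 - \frac{1}{N} \Bigr)^{-(n-1)} \ \le \ \Bigl( 1 - \frac{n-1}{N} \Bigr)^{-1} . \] Moreover, \[ d_{\mathrm{TV}} \bigl( \mathrm{Hyp}(N,L,n), \mathrm{Bin}(n,L/N) \bigr) \ \le \ \Bigl( 1 - \frac{[L]_n}{[N]_n} - \frac{[N-L]_n}{[N]_n} \Bigr) \Bigl( 1 - \Bigl(1 - \frac{1}{N}\Bigr)^{n-1} \Bigr) \ \le \ \Bigl( 1 - \frac{[L]_n}{[N]_n} - \frac{[N-L]_n}{[N]_n} \Bigr) \frac{n-1}{N} . \]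
   Context: $\mathrm{Hyp}(N,L,n)$ is the hypergeometric distribution: the law of the number of black balls among $n$ balls drawn without replacement from an urn with $N$ balls of which $L$ are black; its weights are $\binom{L}{k}\binom{N-L}{n-k}/\binom{N}{n}$. $\mathrm{Bin}(n,p)$ is the binomial distribution. For real $a$ and integers $m \ge 1$, $[a]_m := \prod_{i=0}^{m-1}(a-i)$, $[a]_0 := 1$. For probability measures $Q,P$ on $(\mathcal{X},\mathcal{A})$: $\rho(Q,P) := \sup_{A \in \mathcal{A}} Q(A)/P(A)$ with conventions $0/0 := 0$, $a/0 := \infty$ for $a>0$; and $d_{\mathrm{TV}}(Q,P) := \sup_{A \in \mathcal{A}} |Q(A) - P(A)|$. *)

theory Defs
  imports "HOL-Probability.Probability"
begin

text \<open>Hyp(N,L,n): law of the number of black balls among n balls drawn without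
  replacement (uniformly random n-subset) from an urn with balls 0..N-1,
  of which the balls 0..L-1 are black.\<close>
definition hyp_pmf :: "nat \<Rightarrow> nat \<Rightarrow> nat \<Rightarrow> nat pmf" where
  "hyp_pmf N L n =
     map_pmf (\<lambda>S. card (S \<inter> {..<L})) (pmf_of_set {S. S \<subseteq> {..<N} \<and> card S = n})"

definition falling :: "real \<Rightarrow> nat \<Rightarrow> real" where
  "falling a m = (\<Prod>i<m. (a - real i))"

definition ratio_conv :: "real \<Rightarrow> real \<Rightarrow> ereal" where
  "ratio_conv a b = (if b = 0 then (if a = 0 then 0 else \<infinity>) else ereal (a / b))"

definition rho :: "'a pmf \<Rightarrow> 'a pmf \<Rightarrow> ereal" where
  "rho Q P = (SUP A. ratio_conv (measure_pmf.prob Q A) (measure_pmf.prob P A))"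

definition dTV :: "'a pmf \<Rightarrow> 'a pmf \<Rightarrow> real" where
  "dTV Q P = (SUP A. \<bar>measure_pmf.prob Q A - measure_pmf.prob P A\<bar>)"

end

theory Submission
  imports Defs
begin

text \<open>Write d a m for the product of 1 - i / a over i < m. The hypergeometric weight at k divided by
  the binomial weight is d L k * d (N - L) (n - k) / d N n, while
  (1 - 1/N)^(n-1) * d (N - 1) (n - 1) = d N n. Hence the bound on the density ratio amounts to
  d L k * d (N - L) (n - k) \<le> d (N - 1) (n - 1). For 0 < k < n both sides have the same number of
  nontrivial factors, and one cancels last factors until (k - 1) / L and (n - k - 1) / (N - L) are both at
  most (n - 2) / (N - 1). This confines L to an interval of length one, and there the
  logarithms of both sides are compared through Stirling-type bounds; the condition
  n - 1 \<le> N / 2 makes the gap between these bounds favourable.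

  For the total variation bound, a density ratio of at most 1 / c gives q - p \<le> (1 - c) q pointwise,
  and the hypergeometric weight q is below the binomial weight p at the two extreme values
  0 and n, so that these do not contribute.\<close>

subsection \<open>Logarithmic bounds for products of 1 - i / a\<close>

text \<open>Both sides vanish at 0 and their difference has a nonnegative derivative. The left side
  is the [1/1] Pade approximant of \<open>ln (1 + x)\<close>.\<close>

lemma ln_one_plus_ge_pade:
  fixes x :: real
  assumes "0 \<le> x"
  shows "2 * x / (2 + x) \<le> ln (1 + x)"
proof -
  have "(\<lambda>x. ln (1 + x) - 2 * x / (2 + x)) 0 \<le> (\<lambda>x. ln (1 + x) - 2 * x / (2 + x)) x"
  proof (rule DERIV_nonneg_imp_nondecreasing[OF assms])
    fix y :: real assume y: "0 \<le> y" "y \<le> x"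
    have "((\<lambda>x. ln (1 + x) - 2 * x / (2 + x)) has_real_derivative
        (1 / (1 + y) - (2 * (2 + y) - 2 * y) / (2 + y)\<^sup>2)) (at y)"
      using y by (auto intro!: derivative_eq_intros simp: power2_eq_square)
    moreover have "1 / (1 + y) - (2 * (2 + y) - 2 * y) / (2 + y)\<^sup>2 = y\<^sup>2 / ((1 + y) * (2 + y)\<^sup>2)"
      using y by (simp add: field_simps) (simp add: power2_eq_square algebra_simps)
    moreover have "0 \<le> y\<^sup>2 / ((1 + y) * (2 + y)\<^sup>2)"
      using y by simp
    ultimately show "\<exists>d. ((\<lambda>x. ln (1 + x) - 2 * x / (2 + x)) has_real_derivative d) (at y) \<and> 0 \<le> d"
      by auto
  qed
  then show ?thesis by simp
qed

text \<open>The same argument for the [2/1] Pade approximant, which bounds the logarithm from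
  above.\<close>

lemma ln_one_plus_le_pade:
  fixes x :: real
  assumes "0 \<le> x"
  shows "ln (1 + x) \<le> x * (6 + x) / (6 + 4 * x)"
proof -
  have "(\<lambda>x. x * (6 + x) / (6 + 4 * x) - ln (1 + x)) 0 \<le> (\<lambda>x. x * (6 + x) / (6 + 4 * x) - ln (1 + x)) x"
  proof (rule DERIV_nonneg_imp_nondecreasing[OF assms])
    fix y :: real assume y: "0 \<le> y" "y \<le> x"
    have "((\<lambda>x. x * (6 + x) / (6 + 4 * x) - ln (1 + x)) has_real_derivative
        (((6 + 2 * y) * (6 + 4 * y) - y * (6 + y) * 4) / (6 + 4 * y)\<^sup>2 - 1 / (1 + y))) (at y)"
      using y by (auto intro!: derivative_eq_intros simp: power2_eq_square algebra_simps)
    moreover have "((6 + 2 * y) * (6 + 4 * y) - y * (6 + y) * 4) / (6 + 4 * y)\<^sup>2 - 1 / (1 + y)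
        = 4 * y ^ 3 / ((6 + 4 * y)\<^sup>2 * (1 + y))"
      using y by (simp add: field_simps) (simp add: power2_eq_square power3_eq_cube algebra_simps)
    moreover have "0 \<le> 4 * y ^ 3 / ((6 + 4 * y)\<^sup>2 * (1 + y))"
      using y by simp
    ultimately show "\<exists>d. ((\<lambda>x. x * (6 + x) / (6 + 4 * x) - ln (1 + x)) has_real_derivative d) (at y) \<and> 0 \<le> d"
      by auto
  qed
  then show ?thesis by simp
qed

text \<open>The left side is the integral of 1 + ln over an interval of length one centred at
  \<open>v\<close>; by concavity it is at most the midpoint value. The proof lets the half-width
  \<open>s\<close> grow from 0 to 1/2 and uses (v + s) (v - s) \<le> v^2.\<close>

lemma x_ln_x_central_diff_le:
  fixes v :: real
  assumes "1/2 < v"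
  shows "(v + 1/2) * ln (v + 1/2) - (v - 1/2) * ln (v - 1/2) \<le> 1 + ln v"
proof -
  define g where "g = (\<lambda>s. (v + s) * ln (v + s) - (v - s) * ln (v - s) - 2 * s * (1 + ln v))"
  have "g (1/2) \<le> g 0"
  proof (rule DERIV_nonpos_imp_nonincreasing[where a = 0 and b = "1/2"])
    fix s :: real assume s: "0 \<le> s" "s \<le> 1/2"
    have pos: "0 < v + s" "0 < v - s" "0 < v" using s assms by auto
    have "(g has_real_derivative (ln (v + s) + ln (v - s) - 2 * ln v)) (at s)"
      unfolding g_def using pos by (auto intro!: derivative_eq_intros)
    moreover have "ln ((v + s) * (v - s)) \<le> ln (v * v)"
      using pos by (intro ln_mono mult_pos_pos) (auto simp: algebra_simps)
    then have "ln (v + s) + ln (v - s) - 2 * ln v \<le> 0"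
      using pos by (simp add: ln_mult)
    ultimately show "\<exists>d. (g has_real_derivative d) (at s) \<and> d \<le> 0" by blast
  qed simp
  then show ?thesis by (simp add: g_def)
qed

text \<open>The falling factorial of order m at a, divided by the m-th power of a. For a a positive
  integer, it is the probability that m independent uniform draws from a values are distinct.\<close>

definition distinct_prob :: "real \<Rightarrow> nat \<Rightarrow> real" where
  "distinct_prob a m = (\<Prod>i<m. 1 - real i / a)"

lemma distinct_prob_0 [simp]: "distinct_prob a 0 = 1"
  and distinct_prob_Suc: "distinct_prob a (Suc m) = distinct_prob a m * (1 - real m / a)"
  by (simp_all add: distinct_prob_def)

lemma distinct_prob_1 [simp]: "distinct_prob a (Suc 0) = 1"
  by (simp add: distinct_prob_def)

lemma distinct_prob_pos: "real m < a + 1 \<Longrightarrow> 0 < a \<Longrightarrow> 0 < distinct_prob a m"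
  unfolding distinct_prob_def by (rule prod_pos) (auto simp: field_simps)

lemma distinct_prob_nonneg: "real m \<le> a + 1 \<Longrightarrow> 0 < a \<Longrightarrow> 0 \<le> distinct_prob a m"
  unfolding distinct_prob_def by (rule prod_nonneg) (auto simp: field_simps)

lemma distinct_prob_mono:
  assumes "0 < a" "a \<le> b" "real m \<le> a + 1"
  shows "distinct_prob a m \<le> distinct_prob b m"
  unfolding distinct_prob_def
proof (rule prod_mono)
  fix i assume "i \<in> {..<m}"
  then have "real i \<le> a" using assms by auto
  moreover have "real i / b \<le> real i / a"
    using assms by (simp add: frac_le)
  ultimately show "0 \<le> 1 - real i / a \<and> 1 - real i / a \<le> 1 - real i / b"
    using assms by (auto simp: divide_le_eq_1)
qed

text \<open>The trapezoidal (for the upper bound) and midpoint (for the lower bound) rules for the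
  concave function ln (1 - x / a).\<close>

lemma ln_distinct_prob_le:
  assumes "real K < L"
  shows "ln (distinct_prob L (Suc K)) \<le> - real K + (L - real K - 1/2) * ln (L / (L - real K))"
  using assms
proof (induction K)
  case 0
  then show ?case by simp
next
  case (Suc K)
  define v where "v = L - real (Suc K)"
  have v: "v > 0" "L > 0" "L - real K = v + 1" "L - real (Suc K) = v" using Suc.prems by (auto simp: v_def)
  have "ln (distinct_prob L (Suc (Suc K))) = ln (distinct_prob L (Suc K)) + ln (v / L)"
    unfolding distinct_prob_Suc[of L "Suc K"] using Suc.prems v
    by (subst ln_mult_pos) (auto intro!: distinct_prob_pos simp: v_def field_simps)
  also have "\<dots> \<le> - real K + (v + 1/2) * ln (L / (v + 1)) + ln (v / L)"
    using Suc v by (simp add: add.commute)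
  also have "\<dots> = - real K + (v + 1/2) * (ln L - ln (v + 1)) + ln v - ln L"
    using v by (simp add: ln_div)
  \<comment> \<open>The claimed bound is the integral of ln (1 - x / L) over [0, K] plus half the
    integrand at K. Its increment reduces to 1 \<le> (v + 1/2) ln ((v + 1) / v), the Pade bound at 1
    / v.\<close>
  also have "\<dots> \<le> - real K - 1 + (v - 1/2) * (ln L - ln v)"
  proof -
    have "2 * (1 / v) / (2 + 1 / v) \<le> ln (1 + 1 / v)"
      using v by (intro ln_one_plus_ge_pade) simp
    also have "1 + 1 / v = (v + 1) / v" using v by (simp add: field_simps)
    also have "ln ((v + 1) / v) = ln (v + 1) - ln v" using v by (simp add: ln_div)
    also have "2 * (1 / v) / (2 + 1 / v) = 1 / (v + 1/2)" using v by (simp add: field_simps)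
    finally have "1 \<le> (v + 1/2) * (ln (v + 1) - ln v)" using v by (simp add: field_simps)
    then show ?thesis by (simp add: algebra_simps diff_divide_distrib)
  qed
  also have "\<dots> = - real (Suc K) + (v - 1/2) * ln (L / v)"
    using v by (simp add: ln_div)
  finally show ?case unfolding v .
qed

lemma ln_distinct_prob_ge:
  assumes "real R + 1 \<le> N"
  shows "- (real R + 1/2) + (N - real R - 1/2) * ln (N / (N - real R - 1/2)) \<le> ln (distinct_prob N (Suc R))"
  using assms
proof (induction R)
  case 0
  \<comment> \<open>The claimed bound is the integral of ln (1 - x / N) over [0, R + 1/2]; for R = 0
    it only has to be nonpositive.\<close>
  have "ln (N / (N - 1/2)) \<le> N / (N - 1/2) - 1"
    using 0 by (intro ln_le_minus_one) auto
  also have "\<dots> = 1 / 2 / (N - 1/2)" using 0 by (simp add: field_simps)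
  finally have "(N - 1/2) * ln (N / (N - 1/2)) \<le> 1/2"
    using 0 by (simp add: field_simps)
  then show ?case by simp
next
  case (Suc R)
  define v where "v = N - real (Suc R)"
  have v: "v \<ge> 1" "N > 0" "N - real R - 1/2 = v + 1/2" "N - real (Suc R) - 1/2 = v - 1/2"
    using Suc.prems by (auto simp: v_def)
  have "- (real (Suc R) + 1/2) + (v - 1/2) * ln (N / (v - 1/2))
      = - (real R + 1/2) - 1 + (v - 1/2) * ln N - (v - 1/2) * ln (v - 1/2)"
    using v by (simp add: ln_div algebra_simps)
  also have "\<dots> \<le> - (real R + 1/2) + (v + 1/2) * (ln N - ln (v + 1/2)) + ln v - ln N"
    using x_ln_x_central_diff_le[of v] v by (simp add: algebra_simps)
  also have "\<dots> = - (real R + 1/2) + (v + 1/2) * ln (N / (v + 1/2)) + ln (v / N)"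
    using v by (simp add: ln_div)
  also have "\<dots> \<le> ln (distinct_prob N (Suc R)) + ln (v / N)"
    using Suc.IH Suc.prems unfolding v by simp
  also have "\<dots> = ln (distinct_prob N (Suc (Suc R)))"
    unfolding distinct_prob_Suc[of N "Suc R"] using Suc.prems v
    by (subst ln_mult_pos) (auto intro!: distinct_prob_pos simp: v_def field_simps)
  finally show ?case unfolding v .
qed

subsection \<open>Merging two such products\<close>

text \<open>Budget for \<open>distinct_prob_balanced\<close>: the left side is the cost of passing
  from the trapezoidal to the midpoint bound, the right side the gain supplied by
  \<open>balanced_sum_ge\<close>.\<close>

lemma gap_inequality:
  fixes B W :: real
  assumes B: "1 < B" and W1: "3 * B \<le> W" and W2: "B \<le> (B - 1) * W"
  shows "ln (1 + 1 / B) / 2 + 1 / (8 * W - 2) \<le> (72/25) * B / ((3 * B + 1) * (B + 1))"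
proof -
  have "ln (1 + 1 / B) \<le> (1 / B) * (6 + 1 / B) / (6 + 4 * (1 / B))"
    using B by (intro ln_one_plus_le_pade) simp
  also have "\<dots> = (6 * B + 1) / (2 * B * (3 * B + 2))"
    using B by (simp add: divide_simps)
  finally have "ln (1 + 1 / B) / 2 \<le> (6 * B + 1) / (2 * B * (3 * B + 2)) / 2"
    by (rule divide_right_mono) simp
  also have "\<dots> = (6 * B + 1) / (4 * B * (3 * B + 2))"
    using B by (simp add: divide_simps)
  finally have ln: "ln (1 + 1 / B) / 2 \<le> (6 * B + 1) / (4 * B * (3 * B + 2))" .
  show ?thesis
  \<comment> \<open>The two lower bounds for \<open>W\<close>, namely 3 B and B / (B - 1), coincide
    at B = 4/3; below that point the second one is larger.\<close>
  proof (cases "B \<le> 4/3")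
    case True
    have "1 / (8 * W - 2) \<le> (B - 1) / (2 * (3 * B + 1))"
    proof -
      have "2 * (3 * B + 1) \<le> (B - 1) * (8 * W - 2)" using W2 by (simp add: algebra_simps)
      then show ?thesis using B W1 by (simp add: divide_simps)
    qed
    moreover have "(6 * B + 1) / (4 * B * (3 * B + 2)) + (B - 1) / (2 * (3 * B + 1))
        \<le> (72/25) * B / ((3 * B + 1) * (B + 1))"
    proof -
      define y where "y = B - 1"
      have y: "0 < y" "y \<le> 1/3" "B = y + 1" using B True by (auto simp: y_def)
      have "y * y \<le> 1/3 * y" using y by (intro mult_right_mono) auto
      then have y2: "y * y \<le> y / 3" by simp
      have y3: "y * y * y \<le> y * y * (1/3)" using y by (intro mult_left_mono) auto
      have y4: "y * y * y * y \<le> y * y * y * (1/3)" using y by (intro mult_left_mono) auto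
      \<comment> \<open>With denominators cleared, y \<le> 1/3 lets the terms of low order absorb
        the negative cubic and quartic ones.\<close>
      have "72 * B * (4 * B * (3 * B + 2))
          - 25 * ((6 * B + 1) * (3 * B + 1) * (B + 1) + 2 * B * (3 * B + 2) * (B - 1) * (B + 1))
        = 40 + 294 * y + 93 * (y * y) - 286 * (y * y * y) - 150 * (y * y * y * y)"
        unfolding y(3) by (simp add: algebra_simps)
      then have "25 * ((6 * B + 1) * (3 * B + 1) * (B + 1) + 2 * B * (3 * B + 2) * (B - 1) * (B + 1))
        \<le> 72 * B * (4 * B * (3 * B + 2))"
        using y(1) y2 y3 y4 zero_le_square[of y] by linarith
      moreover have "(6 * B + 1) / (4 * B * (3 * B + 2)) + (B - 1) / (2 * (3 * B + 1))
        = ((6 * B + 1) * (3 * B + 1) * (B + 1) + 2 * B * (3 * B + 2) * (B - 1) * (B + 1))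
          / ((4 * B * (3 * B + 2)) * ((3 * B + 1) * (B + 1)))"
        using B by (simp add: divide_simps) (simp add: algebra_simps)
      moreover have "(72/25) * B / ((3 * B + 1) * (B + 1)) =
         ((72/25) * B * (4 * B * (3 * B + 2))) / ((4 * B * (3 * B + 2)) * ((3 * B + 1) * (B + 1)))"
        using B by (simp add: divide_simps)
      ultimately show ?thesis using B by (simp only:) (rule divide_right_mono, auto)
    qed
    ultimately show ?thesis using ln by linarith
  next
    case False
    have "1 / (8 * W - 2) \<le> 1 / (24 * B - 2)"
      using W1 B by (intro divide_left_mono) auto
    moreover have "(6 * B + 1) / (4 * B * (3 * B + 2)) + 1 / (24 * B - 2)
        \<le> (72/25) * B / ((3 * B + 1) * (B + 1))"
    proof -
      define y where "y = B - 4/3"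
      have y: "0 < y" "B = y + 4/3" using B False by (auto simp: y_def)
      \<comment> \<open>Expanding around 4/3 leaves only positive coefficients.\<close>
      have "72 * B * (4 * B * (3 * B + 2) * (12 * B - 1))
          - 25 * (((6 * B + 1) * (12 * B - 1) + 2 * B * (3 * B + 2)) * ((3 * B + 1) * (B + 1)))
        = 6115/3 + 60422/3 * y + 34733 * (y * y) + 21594 * (y * y * y) + 4518 * (y * y * y * y)"
        unfolding y(2) by (simp add: field_simps)
      moreover have "0 \<le> y * y" "0 \<le> y * y * y" "0 \<le> y * y * y * y" using y by auto
      ultimately have "25 * (((6 * B + 1) * (12 * B - 1) + 2 * B * (3 * B + 2)) * ((3 * B + 1) * (B + 1)))
        \<le> 72 * B * (4 * B * (3 * B + 2) * (12 * B - 1))"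
        using y(1) by linarith
      moreover have "(6 * B + 1) / (4 * B * (3 * B + 2)) + 1 / (24 * B - 2)
        = (((6 * B + 1) * (12 * B - 1) + 2 * B * (3 * B + 2)) * ((3 * B + 1) * (B + 1)))
          / ((4 * B * (3 * B + 2) * (12 * B - 1)) * ((3 * B + 1) * (B + 1)))"
        using B by (simp add: divide_simps) (simp add: algebra_simps)
      moreover have "(72/25) * B / ((3 * B + 1) * (B + 1)) =
         ((72/25) * B * (4 * B * (3 * B + 2) * (12 * B - 1))) / ((4 * B * (3 * B + 2) * (12 * B - 1)) * ((3 * B + 1) * (B + 1)))"
        using B by (simp add: divide_simps)
      ultimately show ?thesis using B by (simp only:) (rule divide_right_mono, auto)
    qed
    ultimately show ?thesis using ln by linarith
  qed
qed

text \<open>The worst case is K = 1, J = 2, where Cauchy-Schwarz gives the constant (1 + sqrt 2)^2;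
  144/25 = (1 + 7/5)^2 is a rational number slightly below it.\<close>

lemma balanced_sum_ge:
  fixes B K J s t :: real
  assumes "0 < B" "1 \<le> K" "2 \<le> J" "0 \<le> s" "0 \<le> t" "s + t = 1"
  shows "144/25 / (3 * B + 1) \<le> K / (B * K + s) + J / (B * J + t)"
proof -
  define p q where "p = B + s" and "q = 2 * B + t"
  have pq: "0 < p" "0 < q" "p + q = 3 * B + 1" using assms by (auto simp: p_def q_def)
  \<comment> \<open>Completed square of q^2 - (69/25) p q + 2 p^2, which is (q + 2 p) (p + q) -
    (144/25) p q.\<close>
  have "0 \<le> (q - 69/50 * p)\<^sup>2 + 239/2500 * p\<^sup>2" by simp
  then have "144/25 * (p * q) \<le> (q + 2 * p) * (p + q)"
    by (simp add: power2_eq_square algebra_simps)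
  then have "144/25 / (p + q) \<le> (q + 2 * p) / (p * q)" 
    using pq by (subst divide_le_eq) (auto simp: field_simps)
  also have "\<dots> = 1 / p + 2 / q" using pq by (simp add: field_simps)
  \<comment> \<open>Dividing by \<open>K\<close> turns the offset \<open>s\<close> into s / K \<le>
    s, which reduces the sum to the worst case; likewise for \<open>J\<close> with t / J \<le> t /
    2.\<close>
  also have "1 / p \<le> K / (B * K + s)"
  proof -
    have "s \<le> s * K" using assms by (simp add: mult_le_cancel_left1)
    moreover have "0 < B * K + s" using assms by (simp add: add_pos_nonneg)
    ultimately show ?thesis using pq by (simp add: p_def pos_le_divide_eq pos_divide_le_eq algebra_simps)
  qed
  also have "2 / q \<le> J / (B * J + t)"
  proof -
    have "t * 2 \<le> t * J" using assms by (intro mult_left_mono) auto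
    moreover have "0 < B * J + t" using assms by (simp add: add_pos_nonneg)
    ultimately show ?thesis using pq by (simp add: q_def pos_le_divide_eq pos_divide_le_eq algebra_simps)
  qed
  finally show ?thesis using pq by simp
qed

text \<open>With R = K + J, B = N / R - 1 and s + t = 1, the two balance hypotheses say
  L - K = B K + s and M - J = B J + t with s, t nonnegative.\<close>

lemma distinct_prob_balanced:
  fixes K J :: nat and L M N :: real
  assumes K: "1 \<le> K" and J: "1 \<le> J" and KJ: "3 \<le> K + J"
    and N: "N = L + M - 1" "2 * real (K + J) + 1 \<le> N"
    and bK: "real K * N \<le> real (K + J) * L" and bJ: "real J * N \<le> real (K + J) * M"
  shows "distinct_prob L (Suc K) * distinct_prob M (Suc J) \<le> distinct_prob N (Suc (K + J))"
proof -
  define R where "R = real (K + J)"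
  define W B where "W = N - R" and "B = W / R"
  define wL wM where "wL = L - real K" and "wM = M - real J"
  define s t where "s = wL - B * real K" and "t = wM - B * real J"
  have R: "3 \<le> R" "R = real K + real J" using KJ by (auto simp: R_def)
  have WR: "R + 1 \<le> W" using N by (simp add: W_def R_def)
  have WB: "W = B * R" using R by (simp add: B_def)
  have B1: "1 < B" using WR R by (simp add: B_def field_simps)
  have W1: "3 * B \<le> W" using WB R B1 by (simp add: mult.commute mult_left_mono)
  \<comment> \<open>\<open>WR\<close> restates \<open>2 * real (K + J) + 1 \<le> N\<close>; it keeps
    B - 1 at least 1 / R.\<close>
  have W2: "B \<le> (B - 1) * W"
  proof -
    have "1 \<le> (B - 1) * R" using WR WB by (simp add: algebra_simps)
    then have "B * 1 \<le> B * ((B - 1) * R)" using B1 by (intro mult_left_mono) auto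
    then show ?thesis using WB by (simp add: algebra_simps)
  qed
  have NB: "N = (B + 1) * R" using WB W_def by (simp add: algebra_simps)
  have "real K * (B + 1) \<le> L" using bK R unfolding NB R_def[symmetric] by simp
  then have s0: "0 \<le> s" by (simp add: s_def wL_def algebra_simps)
  have "real J * (B + 1) \<le> M" using bJ R unfolding NB R_def[symmetric] by simp
  then have t0: "0 \<le> t" by (simp add: t_def wM_def algebra_simps)
  have st: "s + t = 1"
    using N(1) NB R(2) by (simp add: s_def t_def wL_def wM_def algebra_simps)
  have wLs: "wL = B * real K + s" "wM = B * real J + t" by (auto simp: s_def t_def)
  have wpos: "1 < wL" "1 < wM"
  proof -
    have "B * 1 \<le> B * real K" "B * 1 \<le> B * real J" using B1 K J by (intro mult_left_mono; simp)+
    then show "1 < wL" "1 < wM" using wLs s0 t0 B1 by linarith+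
  qed
  have LM: "L = wL + real K" "M = wM + real J" by (auto simp: wL_def wM_def)
  have wsum: "wL + wM = W + 1" using N(1) R(2) by (simp add: W_def wL_def wM_def)
  have d: "144/25 / (3 * B + 1) \<le> real K / wL + real J / wM"
  proof (cases "2 \<le> J")
    case True
    then show ?thesis unfolding wLs using K B1 s0 t0 st by (intro balanced_sum_ge) auto
  next
    case False
    then have "2 \<le> K" using KJ by simp
    then have "144/25 / (3 * B + 1) \<le> real J / wM + real K / wL"
      unfolding wLs using J B1 s0 t0 st by (intro balanced_sum_ge) auto
    then show ?thesis by simp
  qed
  define T where "T = N / W"
  have TB: "T = 1 + 1 / B" unfolding T_def NB WB using B1 R(1) by (simp add: add_divide_distrib)
  have Tpos: "0 < T" using TB B1 by (simp add: add_pos_pos)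
  \<comment> \<open>The tangent of ln at \<open>T\<close> bounds ln ((w + k) / w). Here T = (B + 1)
    / B is the value of L / wL for s = 0 and of M / wM for t = 0.\<close>
  have tangent: "(w - 1/2) * ln ((w + k) / w) \<le> (w - 1/2) * ln T + (w + k - 1/2 - k / w / 2) / T - (w - 1/2)"
    if "1 < w" "0 \<le> k" for w k
  proof -
    have "ln ((w + k) / w / T) \<le> (w + k) / w / T - 1"
      using that Tpos by (intro ln_le_minus_one) auto
    moreover have "ln ((w + k) / w / T) = ln ((w + k) / w) - ln T"
      using that Tpos by (simp add: ln_div ln_mult)
    ultimately have "(w - 1/2) * ln ((w + k) / w) \<le> (w - 1/2) * (ln T + (w + k) / w / T - 1)"
      using that by (intro mult_left_mono) auto
    also have "\<dots> = (w - 1/2) * ln T + (w - 1/2) * ((w + k) / w) / T - (w - 1/2)"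
      by (simp only: right_diff_distrib distrib_left times_divide_eq_right mult_1_right)
    also have "(w - 1/2) * ((w + k) / w) = w + k - 1/2 - k / w / 2"
      using that by (simp add: field_simps)
    finally show ?thesis .
  qed
  have "ln (distinct_prob L (Suc K) * distinct_prob M (Suc J))
      = ln (distinct_prob L (Suc K)) + ln (distinct_prob M (Suc J))"
    using wpos by (intro ln_mult_pos distinct_prob_pos) (auto simp: LM)
  also have "\<dots> \<le> (- real K + (wL - 1/2) * ln (L / wL)) + (- real J + (wM - 1/2) * ln (M / wM))"
    using ln_distinct_prob_le[of K L] ln_distinct_prob_le[of J M] wpos
    by (intro add_mono) (auto simp: wL_def wM_def)
  \<comment> \<open>The weights \<open>wL - 1/2\<close> and \<open>wM - 1/2\<close> add up to
    \<open>W\<close>, so the two tangent bounds combine into a single ln T; the terms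
    \<open>k / w / 2\<close> form the sum bounded below in \<open>d\<close>.\<close>
  also have "\<dots> \<le> - R + W * ln T + (N - (real K / wL + real J / wM) / 2) / T - W"
  proof -
    have "(wL - 1/2) * ln (L / wL) + (wM - 1/2) * ln (M / wM)
      \<le> ((wL - 1/2) + (wM - 1/2)) * ln T
        + ((wL + real K - 1/2 - real K / wL / 2) + (wM + real J - 1/2 - real J / wM / 2)) / T
        - ((wL - 1/2) + (wM - 1/2))"
      using tangent[of wL "real K"] tangent[of wM "real J"] wpos
      unfolding LM distrib_right[of "wL - 1/2" "wM - 1/2"]
        add_divide_distrib[of "wL + real K - 1/2 - real K / wL / 2" "wM + real J - 1/2 - real J / wM / 2"]
      by linarith
    also have "(wL - 1/2) + (wM - 1/2) = W" using wsum by simp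
    also have "(wL + real K - 1/2 - real K / wL / 2) + (wM + real J - 1/2 - real J / wM / 2)
        = N - (real K / wL + real J / wM) / 2" using N(1) LM by argo
    finally show ?thesis using R by simp
  qed
  also have "\<dots> \<le> - R + W * ln T + (N - (144/25 / (3 * B + 1)) / 2) / T - W"
    using d Tpos by (intro add_mono diff_mono divide_right_mono order_refl) auto
  also have "\<dots> = - R + W * ln T - (72/25) * B / ((3 * B + 1) * (B + 1))"
  proof -
    have "N / T = W" using R N by (simp add: T_def R_def)
    moreover have "(144/25 / (3 * B + 1)) / 2 / T = (72/25) * B / ((3 * B + 1) * (B + 1))"
    proof -
      have "T = (B + 1) / B" unfolding TB using B1 by (simp add: field_simps)
      moreover have "144/25 / P / 2 / ((B + 1) / B) = (72/25) * B / (P * (B + 1))" for P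
        by simp
      ultimately show ?thesis by (simp only:)
    qed
    ultimately show ?thesis by (simp add: diff_divide_distrib)
  qed
  also have "\<dots> \<le> - R + W * ln T - (ln T / 2 + 1 / (8 * W - 2))"
    using gap_inequality[OF B1 W1 W2] unfolding TB by simp
  \<comment> \<open>Replacing \<open>W\<close> by \<open>W - 1/2\<close> in the denominator inside
    the logarithm gains at least 1/2 - 1 / (8 W - 2), by the Pade bound.\<close>
  also have "\<dots> \<le> - (R + 1/2) + (W - 1/2) * ln (N / (W - 1/2))"
  proof -
    have W: "4 \<le> W" using WR R by simp
    have "(1/2) / (W - 1/2) * 2 / (2 + (1/2) / (W - 1/2)) \<le> ln (1 + (1/2) / (W - 1/2))"
      using ln_one_plus_ge_pade[of "(1/2) / (W - 1/2)"] W by (simp add: mult.commute)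
    also have "1 + (1/2) / (W - 1/2) = W / (W - 1/2)" using W by (simp add: field_simps)
    also have "(1/2) / (W - 1/2) * 2 / (2 + (1/2) / (W - 1/2)) = 1 / (2 * W - 1/2)"
      using W by (simp add: divide_simps)
    finally have "(W - 1/2) * (1 / (2 * W - 1/2)) \<le> (W - 1/2) * ln (W / (W - 1/2))"
      using W by (intro mult_left_mono) auto
    also have "(W - 1/2) * (1 / (2 * W - 1/2)) = 1/2 - 1 / (8 * W - 2)"
      using W by (simp add: divide_simps) (simp add: algebra_simps)
    finally have "1/2 - 1 / (8 * W - 2) \<le> (W - 1/2) * ln (W / (W - 1/2))" .
    moreover have "N / (W - 1/2) = T * (W / (W - 1/2))" using W by (simp add: T_def)
    then have "ln (N / (W - 1/2)) = ln T + ln (W / (W - 1/2))"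
      using W Tpos by (simp only:) (intro ln_mult_pos, auto)
    ultimately show ?thesis by (simp add: algebra_simps)
  qed
  also have "\<dots> \<le> ln (distinct_prob N (Suc (K + J)))"
    using ln_distinct_prob_ge[of "K + J" N] N(2) by (simp add: W_def R_def)
  finally have "ln (distinct_prob L (Suc K) * distinct_prob M (Suc J)) \<le> ln (distinct_prob N (Suc (K + J)))" .
  moreover have "0 < distinct_prob L (Suc K) * distinct_prob M (Suc J)"
    using wpos by (intro mult_pos_pos distinct_prob_pos) (auto simp: LM)
  moreover have "0 < distinct_prob N (Suc (K + J))"
    using N(2) by (intro distinct_prob_pos) auto
  ultimately show ?thesis by simp
qed

text \<open>The case K = J = 1, which \<open>distinct_prob_balanced\<close> does not cover. The left
  side is 1 - N / (L M) with N = L + M - 1, so AM-GM reduces the claim to a polynomial inequality in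
  N that holds for N \<ge> 5.\<close>

lemma distinct_prob_two_le:
  fixes L M :: real
  assumes "5 \<le> L + M - 1" "1 \<le> L" "1 \<le> M"
  shows "distinct_prob L (Suc 1) * distinct_prob M (Suc 1) \<le> distinct_prob (L + M - 1) (Suc (1 + 1))"
proof -
  define N where "N = L + M - 1"
  have N: "5 \<le> N" and LM: "L + M = N + 1" using assms by (auto simp: N_def)
  have "0 \<le> (L - M)\<^sup>2" by simp
  then have AG: "4 * (L * M) \<le> (N + 1)\<^sup>2"
    unfolding LM[symmetric] by (simp add: power2_eq_square algebra_simps)
  have "(1 - 1 / L) * (1 - 1 / M) = 1 - N / (L * M)"
    using assms by (simp add: N_def field_simps)
  also have "\<dots> \<le> 1 - 4 * N / (N + 1)\<^sup>2"
  proof -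
    have "4 * N / (N + 1)\<^sup>2 \<le> 4 * N / (4 * (L * M))"
      using AG N assms by (intro divide_left_mono) auto
    then show ?thesis using assms by simp
  qed
  also have "\<dots> \<le> (1 - 1 / N) * (1 - 2 / N)"
  proof -
    have "4 * N * N\<^sup>2 - (3 * N - 2) * (N + 1)\<^sup>2 = (N - 5) * N\<^sup>2 + N\<^sup>2 + N + 2"
      by (simp add: power2_eq_square algebra_simps)
    moreover have "0 \<le> \<dots>" using N by simp
    ultimately have "(3 * N - 2) * (N + 1)\<^sup>2 \<le> 4 * N * N\<^sup>2" by linarith
    then have "(3 * N - 2) / N\<^sup>2 \<le> 4 * N / (N + 1)\<^sup>2"
      using N by (subst frac_le_eq) (auto simp: divide_nonpos_pos algebra_simps)
    moreover have "(1 - 1 / N) * (1 - 2 / N) = 1 - (3 * N - 2) / N\<^sup>2"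
      using N by (simp add: field_simps power2_eq_square)
    ultimately show ?thesis by simp
  qed
  finally show ?thesis by (simp add: distinct_prob_Suc N_def)
qed

text \<open>Equality holds for L = 1, K = 0. In the induction, a last factor on the left which is at most
  the last factor on the right is cancelled; otherwise the parameters are balanced.\<close>

lemma distinct_prob_mult_le:
  fixes L M :: real
  assumes "1 \<le> L" "1 \<le> M" "real K < L" "real J < M" "2 * real (K + J) + 1 \<le> L + M - 1"
  shows "distinct_prob L (Suc K) * distinct_prob M (Suc J) \<le> distinct_prob (L + M - 1) (Suc (K + J))"
  using assms(3-)
proof (induction "K + J" arbitrary: K J rule: less_induct)
  case less
  define N where "N = L + M - 1"
  have N: "2 * real (K + J) + 1 \<le> N" using less.prems by (simp add: N_def)
  consider "K = 0" | "J = 0" | "1 \<le> K" "1 \<le> J" by fastforce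
  then show ?case
  proof cases
    case 1
    then show ?thesis using assms(1,2) less.prems by (auto intro!: distinct_prob_mono)
  next
    case 2
    then show ?thesis using assms(1,2) less.prems by (auto intro!: distinct_prob_mono)
  next
    case KJ: 3
    have nn: "0 \<le> distinct_prob L (Suc K)" "0 \<le> distinct_prob M (Suc J)" "0 \<le> distinct_prob N (K + J)"
      using assms(1,2) less.prems N by (auto intro!: distinct_prob_nonneg)
    have "real (K + J) < N" using N by simp
    then have pos: "0 \<le> 1 - real (K + J) / N" "0 \<le> 1 - real K / L" "0 \<le> 1 - real J / M"
      using assms(1,2) less.prems by (auto simp: divide_le_eq_1)
    consider "real (K + J) * L < real K * N" | "real (K + J) * M < real J * N"
      | "real K * N \<le> real (K + J) * L" "real J * N \<le> real (K + J) * M" by linarith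
    then show ?thesis
    proof cases
      case 1
      obtain K' where K': "K = Suc K'" using KJ by (cases K) auto
      have "1 - real K / L \<le> 1 - real (K + J) / N"
        using 1 N assms(1) by (simp add: pos_le_divide_eq pos_divide_le_eq del: of_nat_add)
      moreover have "distinct_prob L (Suc K') * distinct_prob M (Suc J) \<le> distinct_prob N (K + J)"
        using less.hyps[of K' J] less.prems by (simp add: K' N_def)
      ultimately have "distinct_prob L (Suc K') * distinct_prob M (Suc J) * (1 - real K / L)
          \<le> distinct_prob N (K + J) * (1 - real (K + J) / N)"
        using nn pos by (intro mult_mono) auto
      then show ?thesis
        unfolding N_def[symmetric] distinct_prob_Suc[of N "K + J"] distinct_prob_Suc[of L K]
        by (simp add: K' mult_ac)
    next
      case 2
      obtain J' where J': "J = Suc J'" using KJ by (cases J) auto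
      have "1 - real J / M \<le> 1 - real (K + J) / N"
        using 2 N assms(2) by (simp add: pos_le_divide_eq pos_divide_le_eq del: of_nat_add)
      moreover have "distinct_prob L (Suc K) * distinct_prob M (Suc J') \<le> distinct_prob N (K + J)"
        using less.hyps[of K J'] less.prems by (simp add: J' N_def)
      ultimately have "distinct_prob L (Suc K) * distinct_prob M (Suc J') * (1 - real J / M)
          \<le> distinct_prob N (K + J) * (1 - real (K + J) / N)"
        using nn pos by (intro mult_mono) auto
      then show ?thesis
        unfolding N_def[symmetric] distinct_prob_Suc[of N "K + J"] distinct_prob_Suc[of M J]
        by (simp add: J' mult_ac)
    next
      case 3
      show ?thesis
      proof (cases "K = 1 \<and> J = 1")
        case True
        then show ?thesis using distinct_prob_two_le[of L M] assms(1,2) N by (simp add: N_def)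
      next
        case False
        then have "3 \<le> K + J" using KJ by linarith
        then show ?thesis using distinct_prob_balanced[of K J N L M] KJ N 3
          by (simp add: N_def)
      qed
    qed
  qed
qed

subsection \<open>Hypergeometric and binomial weights\<close>

text \<open>A set is determined by its black part below \<open>L\<close> and its white part from
  \<open>L\<close> on, and the two are chosen independently.\<close>

lemma card_subsets_Int_lessThan:
  assumes "L \<le> N" "k \<le> n"
  shows "card {S. S \<subseteq> {..<N} \<and> card S = n \<and> card (S \<inter> {..<L}) = k}
       = (L choose k) * ((N - L) choose (n - k))"
proof -
  let ?A = "{S. S \<subseteq> {..<L} \<and> card S = k}" and ?B = "{S. S \<subseteq> {L..<N} \<and> card S = n - k}"
  have "bij_betw (\<lambda>(S, T). S \<union> T) (?A \<times> ?B)
      {S. S \<subseteq> {..<N} \<and> card S = n \<and> card (S \<inter> {..<L}) = k}"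
  proof (rule bij_betwI[where g = "\<lambda>S. (S \<inter> {..<L}, S \<inter> {L..<N})"])
    show "(\<lambda>(S, T). S \<union> T) \<in> ?A \<times> ?B \<rightarrow> {S. S \<subseteq> {..<N} \<and> card S = n \<and> card (S \<inter> {..<L}) = k}"
    proof (clarify, intro conjI)
      fix S T assume S: "S \<subseteq> {..<L}" "k = card S" and T: "T \<subseteq> {L..<N}" "card T = n - card S"
      show "S \<union> T \<subseteq> {..<N}" using S T assms by (auto simp: subset_iff)
      have "(S \<union> T) \<inter> {..<L} = S" using S T by (auto simp: subset_iff)
      then show "card ((S \<union> T) \<inter> {..<L}) = card S" by simp
      have "finite S" "finite T"
        using S T by (auto intro: finite_subset)
      moreover have "S \<inter> T = {}" using S(1) T(1) by fastforce
      ultimately have "card (S \<union> T) = card S + card T"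
        by (rule card_Un_disjoint)
      then show "card (S \<union> T) = n" using S T assms by simp
    qed
    show "(\<lambda>S. (S \<inter> {..<L}, S \<inter> {L..<N})) \<in> {S. S \<subseteq> {..<N} \<and> card S = n \<and> card (S \<inter> {..<L}) = k} \<rightarrow> ?A \<times> ?B"
    proof
      fix S assume "S \<in> {S. S \<subseteq> {..<N} \<and> card S = n \<and> card (S \<inter> {..<L}) = k}"
      then have S: "S \<subseteq> {..<N}" "card S = n" "card (S \<inter> {..<L}) = k" by auto
      have "card S = card (S \<inter> {..<L} \<union> S \<inter> {L..<N})"
        using S(1) by (intro arg_cong[where f = card]) (auto simp: subset_iff)
      also have "\<dots> = card (S \<inter> {..<L}) + card (S \<inter> {L..<N})"
        by (intro card_Un_disjoint) auto
      finally show "(S \<inter> {..<L}, S \<inter> {L..<N}) \<in> ?A \<times> ?B" using S by auto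
    qed
  qed (use assms in \<open>auto simp: subset_iff\<close>)
  then have "card {S. S \<subseteq> {..<N} \<and> card S = n \<and> card (S \<inter> {..<L}) = k} = card (?A \<times> ?B)"
    by (simp add: bij_betw_same_card)
  also have "\<dots> = (L choose k) * ((N - L) choose (n - k))"
    by (simp add: card_cartesian_product n_subsets)
  finally show ?thesis .
qed

lemma
  assumes "n \<le> N" "L \<le> N"
  shows pmf_hyp_pmf: "k \<le> n \<Longrightarrow>
      pmf (hyp_pmf N L n) k = real (L choose k) * real ((N - L) choose (n - k)) / real (N choose n)"
    and set_pmf_hyp_pmf: "set_pmf (hyp_pmf N L n) \<subseteq> {..n}"
proof -
  let ?U = "{S. S \<subseteq> {..<N} \<and> card S = n}"
  have fin: "finite ?U" by simp
  have cardU: "card ?U = N choose n" using n_subsets[of "{..<N}" n] by simp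
  have ne: "?U \<noteq> {}" using zero_less_binomial[OF assms(1)] unfolding cardU[symmetric] by (auto simp only: card.empty)
  show "pmf (hyp_pmf N L n) k = real (L choose k) * real ((N - L) choose (n - k)) / real (N choose n)"
    if "k \<le> n"
  proof -
    have "pmf (hyp_pmf N L n) k = real (card (?U \<inter> (\<lambda>S. card (S \<inter> {..<L})) -` {k})) / real (card ?U)"
      unfolding hyp_pmf_def pmf_map by (rule measure_pmf_of_set[OF ne fin])
    also have "?U \<inter> (\<lambda>S. card (S \<inter> {..<L})) -` {k}
        = {S. S \<subseteq> {..<N} \<and> card S = n \<and> card (S \<inter> {..<L}) = k}" by auto
    finally show ?thesis using that assms cardU by (simp add: card_subsets_Int_lessThan)
  qed
  show "set_pmf (hyp_pmf N L n) \<subseteq> {..n}"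
  proof -
    have "card (S \<inter> {..<L}) \<le> card S" if "S \<in> ?U" for S
      using that by (intro card_mono) (auto intro: finite_subset)
    then show ?thesis unfolding hyp_pmf_def set_map_pmf set_pmf_of_set[OF ne fin] by auto
  qed
qed

section \<open>Weights and their ratio in terms of \<open>distinct_prob\<close>\<close>

lemma of_nat_binomial_eq_falling: "real (a choose k) = falling (real a) k / fact k"
  by (simp add: binomial_gbinomial gbinomial_prod_rev falling_def atLeast0LessThan)

lemma falling_eq_distinct_prob: "falling a m = a ^ m * distinct_prob a m"
\<comment> \<open>At a = 0 division by zero makes every factor of \<open>distinct_prob\<close> equal
  to 1, but for m > 0 both sides still vanish. This covers urns with a single colour.\<close>
proof (cases "a = 0 \<and> m \<noteq> 0")
  case True
  then show ?thesis by (auto simp: falling_def power_0_left intro!: prod_zero bexI[of _ 0])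
next
  case False
  then have "falling a m = (\<Prod>i<m. a * (1 - real i / a))"
    unfolding falling_def by (intro prod.cong) (auto simp: field_simps)
  then show ?thesis by (simp add: distinct_prob_def prod.distrib)
qed

text \<open>Factor by factor, (1 - 1/N) (1 - i / (N - 1)) = 1 - (i + 1) / N, and the factor for
  index 0 on the right is 1.\<close>

lemma distinct_prob_shift:
  assumes "1 \<le> n" "n \<le> N"
  shows "(1 - 1 / real N) ^ (n - 1) * distinct_prob (real N - 1) (n - 1) = distinct_prob (real N) n"
proof -
  obtain m where m: "n = Suc m" using assms by (cases n) auto
  have "(1 - 1 / real N) ^ m * distinct_prob (real N - 1) m
      = (\<Prod>i<m. (1 - 1 / real N) * (1 - real i / (real N - 1)))"
    by (simp add: distinct_prob_def prod.distrib)
  also have "\<dots> = (\<Prod>i<m. 1 - real (Suc i) / real N)"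
  proof (rule prod.cong)
    fix i assume "i \<in> {..<m}"
    \<comment> \<open>An index i < m exists only if n \<ge> 2, which excludes N = 1.\<close>
    then have "real N - 1 \<noteq> 0" "real N \<noteq> 0" using assms m by auto
    then show "(1 - 1 / real N) * (1 - real i / (real N - 1)) = 1 - real (Suc i) / real N"
      by (simp add: divide_simps)
  qed simp
  also have "\<dots> = distinct_prob (real N) (Suc m)"
    unfolding distinct_prob_def by (subst prod.lessThan_Suc_shift) simp
  finally show ?thesis by (simp add: m)
qed

text \<open>Each binomial coefficient splits into a power, which goes into the binomial weight, and
  a \<open>distinct_prob\<close>. The form without a quotient of weights also covers vanishing
  binomial weights.\<close>

lemma pmf_hyp_pmf_eq_binomial:
  assumes "1 \<le> n" "n \<le> N" "L \<le> N" "k \<le> n"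
  shows "pmf (hyp_pmf N L n) k * distinct_prob (real N) n
       = pmf (binomial_pmf n (real L / real N)) k
         * (distinct_prob (real L) k * distinct_prob (real (N - L)) (n - k))"
proof -
  have N0: "0 < real N" and p: "0 \<le> real L / real N" "real L / real N \<le> 1" using assms by auto
  have dN: "distinct_prob (real N) n \<noteq> 0" using distinct_prob_pos[of n "real N"] assms by simp
  have q: "1 - real L / real N = real (N - L) / real N" using assms by (simp add: field_simps)
  have "pmf (hyp_pmf N L n) k = (falling (real L) k / fact k) * (falling (real (N - L)) (n - k) / fact (n - k))
      / (falling (real N) n / fact n)"
    unfolding pmf_hyp_pmf[OF assms(2-4)] of_nat_binomial_eq_falling ..
  also have "\<dots> = real (n choose k) * falling (real L) k * falling (real (N - L)) (n - k) / falling (real N) n"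
    by (simp add: binomial_fact[OF assms(4)])
  finally have h: "pmf (hyp_pmf N L n) k * distinct_prob (real N) n
      = real (n choose k) * (real L ^ k * distinct_prob (real L) k)
        * (real (N - L) ^ (n - k) * distinct_prob (real (N - L)) (n - k)) / real N ^ n"
    using dN N0 unfolding falling_eq_distinct_prob by simp
  have "pmf (binomial_pmf n (real L / real N)) k
      = real (n choose k) * (real L / real N) ^ k * (real (N - L) / real N) ^ (n - k)"
    unfolding pmf_binomial[OF p] q ..
  also have "\<dots> = real (n choose k) * real L ^ k * real (N - L) ^ (n - k) / real N ^ n"
    using assms(4) by (simp add: power_divide power_add[symmetric])
  finally show ?thesis unfolding h by simp
qed

text \<open>For 0 < k < n this is \<open>distinct_prob_mult_le\<close>; for k = 0 and k = n
  monotonicity gives \<open>distinct_prob N n\<close>, which \<open>distinct_prob_shift\<close>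
  bounds by the right side.\<close>

lemma distinct_prob_split_le:
  assumes n: "1 \<le> n" "n \<le> N" "real (n - 1) \<le> real N / 2" and L: "L \<le> N" and k: "k \<le> n"
    and kL: "k \<le> L" "n - k \<le> N - L"
  shows "distinct_prob (real L) k * distinct_prob (real (N - L)) (n - k) \<le> distinct_prob (real N - 1) (n - 1)"
proof -
  have N: "distinct_prob (real N) n \<le> distinct_prob (real N - 1) (n - 1)"
  proof -
    have "0 \<le> distinct_prob (real N - 1) (n - 1)"
      using n by (cases "n = 1") (auto intro!: distinct_prob_nonneg)
    then show ?thesis
      using n unfolding distinct_prob_shift[OF n(1,2), symmetric]
      by (intro mult_left_le_one_le power_le_one) auto
  qed
  have mono: "distinct_prob (real a) n \<le> distinct_prob (real N) n" if "n \<le> a" "a \<le> N" for a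
    using that n by (intro distinct_prob_mono) auto
  consider "k = 0" | "k = n" | "1 \<le> k" "1 \<le> n - k" using k by linarith
  then show ?thesis
  proof cases
    case 1
    then show ?thesis using mono[of "N - L"] N kL by simp
  next
    case 2
    then show ?thesis using mono[of L] N kL L by simp
  next
    case 3
    define K J where "K = k - 1" and "J = n - k - 1"
    have KJ: "k = Suc K" "n - k = Suc J" "n - 1 = Suc (K + J)" "n = Suc (Suc (K + J))"
      using 3 by (auto simp: K_def J_def)
    \<comment> \<open>Since n - 1 = K + J + 1, the condition n - 1 \<le> N / 2 is exactly 2 (K + J)
      + 1 \<le> N - 1.\<close>
    have "distinct_prob (real L) (Suc K) * distinct_prob (real (N - L)) (Suc J)
        \<le> distinct_prob (real L + real (N - L) - 1) (Suc (K + J))"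
      using 3 kL n(3) L unfolding KJ by (intro distinct_prob_mult_le) (auto simp: field_simps)
    also have "real L + real (N - L) = real N" using L by simp
    finally show ?thesis using KJ(2,3) by (simp add: KJ(1))
  qed
qed

lemma pmf_hyp_pmf_le:
  assumes n: "1 \<le> n" "n \<le> N" "real (n - 1) \<le> real N / 2" and L: "L \<le> N"
  shows "(1 - 1 / real N) ^ (n - 1) * pmf (hyp_pmf N L n) k \<le> pmf (binomial_pmf n (real L / real N)) k"
proof -
  let ?h = "pmf (hyp_pmf N L n) k" and ?b = "pmf (binomial_pmf n (real L / real N)) k"
  consider "?h = 0" | "k \<le> n" "k \<le> L" "n - k \<le> N - L"
  proof (cases "k \<le> n")
    case True
    then show ?thesis using pmf_hyp_pmf[OF n(2) L True] that
      by (cases "k \<le> L"; cases "n - k \<le> N - L") (auto simp: binomial_eq_0)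
  next
    case False
    then show ?thesis using set_pmf_hyp_pmf[OF n(2) L] that(1) by (auto simp: set_pmf_iff subset_iff)
  qed
  then show ?thesis
  proof cases
    case 1
    then show ?thesis by simp
  next
    case 2
    define d where "d = distinct_prob (real N - 1) (n - 1)"
    \<comment> \<open>For n = 1 the product is empty; this case is separate because N - 1 may then
      be 0.\<close>
    have d: "0 < d" unfolding d_def
      using n by (cases "n = 1") (auto intro!: distinct_prob_pos)
    have "(1 - 1 / real N) ^ (n - 1) * ?h * d = ?h * distinct_prob (real N) n"
      unfolding d_def distinct_prob_shift[OF n(1,2), symmetric] by simp
    also have "\<dots> \<le> ?b * d"
      unfolding pmf_hyp_pmf_eq_binomial[OF n(1,2) L 2(1)] d_def
      by (intro mult_left_mono distinct_prob_split_le assms 2) simp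
    finally show ?thesis using d by simp
  qed
qed

section \<open>From pointwise bounds to \<open>rho\<close> and \<open>dTV\<close>\<close>

lemma prob_le_prob_if_pmf_le:
  fixes p q :: "'a pmf"
  assumes "\<And>k. c * pmf p k \<le> pmf q k"
  shows "c * measure_pmf.prob p A \<le> measure_pmf.prob q A"
proof -
  have "c * measure_pmf.prob p A = infsetsum (\<lambda>k. c * pmf p k) A"
    by (simp add: measure_pmf_conv_infsetsum infsetsum_cmult_right pmf_abs_summable)
  also have "\<dots> \<le> infsetsum (pmf q) A"
    using assms by (intro infsetsum_mono abs_summable_on_cmult_right pmf_abs_summable) auto
  finally show ?thesis by (simp add: measure_pmf_conv_infsetsum)
qed

lemma ratio_conv_le:
  assumes "0 < c" "c * a \<le> b" "0 \<le> a" "0 \<le> b"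
  shows "ratio_conv a b \<le> ereal (inverse c)"
proof (cases "b = 0")
  case True
  \<comment> \<open>The infinite value in \<open>ratio_conv\<close> cannot occur: b = 0 forces a =
    0.\<close>
  then have "a = 0" using assms by (simp add: mult_le_0_iff)
  then show ?thesis using True assms by (simp add: ratio_conv_def)
next
  case False
  then show ?thesis using assms by (simp add: ratio_conv_def field_simps)
qed

lemma rho_le:
  fixes p q :: "'a pmf"
  assumes "0 < c" "\<And>k. c * pmf p k \<le> pmf q k"
  shows "rho p q \<le> ereal (inverse c)"
  unfolding rho_def
  by (intro SUP_least ratio_conv_le assms prob_le_prob_if_pmf_le) auto

text \<open>Passing to the complement of \<open>A\<close> flips the sign of the difference, so a
  one-sided bound for all events suffices.\<close>

lemma dTV_le:
  assumes "\<And>A. measure_pmf.prob p A - measure_pmf.prob q A \<le> e"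
  shows "dTV p q \<le> e"
  unfolding dTV_def
proof (rule cSUP_least)
  fix A
  have "measure_pmf.prob p (- A) = 1 - measure_pmf.prob p A" for p :: "'a pmf"
    using measure_pmf.prob_compl[of A p] by (simp add: Compl_eq_Diff_UNIV)
  then show "\<bar>measure_pmf.prob p A - measure_pmf.prob q A\<bar> \<le> e"
    using assms[of A] assms[of "- A"] by (simp add: abs_le_iff)
qed simp

section \<open>The extreme values 0 and \<open>n\<close>: samples of one colour\<close>

lemma pmf_hyp_pmf_extreme:
  assumes "n \<le> N" "L \<le> N"
  shows "pmf (hyp_pmf N L n) 0 = falling (real N - real L) n / falling (real N) n"
    and "pmf (hyp_pmf N L n) n = falling (real L) n / falling (real N) n"
  using pmf_hyp_pmf[OF assms, of 0] pmf_hyp_pmf[OF assms, of n] assms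
  by (simp_all add: of_nat_binomial_eq_falling of_nat_diff)

text \<open>Drawing only from \<open>a\<close> given balls is less likely without replacement:
  \<open>distinct_prob\<close> increases in its first argument, and for a < n the falling factorial
  contains the factor 0.\<close>

lemma falling_ratio_le_power:
  assumes "1 \<le> n" "n \<le> N" "a \<le> N"
  shows "falling (real a) n / falling (real N) n \<le> (real a / real N) ^ n"
proof -
  have N: "0 < distinct_prob (real N) n" using assms by (intro distinct_prob_pos) auto
  have Nf: "0 < falling (real N) n"
    using N assms by (simp add: falling_eq_distinct_prob)
  show ?thesis
  proof (cases "n \<le> a")
    case True
    then have "distinct_prob (real a) n \<le> distinct_prob (real N) n"
      using assms by (intro distinct_prob_mono) auto
    then have "falling (real a) n / falling (real N) n \<le> (real a ^ n * distinct_prob (real N) n) / falling (real N) n"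
      unfolding falling_eq_distinct_prob[of "real a"] using Nf by (intro divide_right_mono mult_left_mono) auto
    also have "\<dots> = (real a / real N) ^ n"
      using N by (simp add: falling_eq_distinct_prob power_divide)
    finally show ?thesis .
  next
    case False
    then have "falling (real a) n = 0" by (auto simp: falling_def intro!: prod_zero bexI[of _ a])
    then show ?thesis by simp
  qed
qed

lemma pmf_hyp_pmf_extreme_le:
  assumes "1 \<le> n" "n \<le> N" "L \<le> N" "k = 0 \<or> k = n"
  shows "pmf (hyp_pmf N L n) k \<le> pmf (binomial_pmf n (real L / real N)) k"
proof -
  have p: "0 \<le> real L / real N" "real L / real N \<le> 1" using assms by auto
  have q: "1 - real L / real N = real (N - L) / real N" using assms by (simp add: field_simps)
  show ?thesis
    using assms(4) falling_ratio_le_power[OF assms(1,2), of "N - L"] falling_ratio_le_power[OF assms(1-3)] assms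
    unfolding pmf_binomial[OF p] q
    by (auto simp: pmf_hyp_pmf_extreme[OF assms(2,3)] of_nat_diff)
qed

theorem theorem2:
  fixes N L n :: nat
  assumes "1 \<le> n" and "n \<le> N" and "real (n - 1) \<le> real N / 2" and "L \<le> N"
  shows "rho (hyp_pmf N L n) (binomial_pmf n (real L / real N))
           \<le> rho (hyp_pmf N 1 n) (binomial_pmf n (1 / real N)) \<and>
         rho (hyp_pmf N 1 n) (binomial_pmf n (1 / real N))
           = ereal (inverse ((1 - 1 / real N) ^ (n - 1))) \<and>
         inverse ((1 - 1 / real N) ^ (n - 1)) \<le> inverse (1 - real (n - 1) / real N) \<and>
         dTV (hyp_pmf N L n) (binomial_pmf n (real L / real N))
           \<le> (1 - falling (real L) n / falling (real N) n
                - falling (real N - real L) n / falling (real N) n)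
             * (1 - (1 - 1 / real N) ^ (n - 1)) \<and>
         (1 - falling (real L) n / falling (real N) n
                - falling (real N - real L) n / falling (real N) n)
             * (1 - (1 - 1 / real N) ^ (n - 1))
           \<le> (1 - falling (real L) n / falling (real N) n
                - falling (real N - real L) n / falling (real N) n)
             * (real (n - 1) / real N)"
proof -
  define c where "c = (1 - 1 / real N) ^ (n - 1)"
  have N0: "0 < real N" using assms by auto
  \<comment> \<open>If N = 1, then n = 1 and \<open>c\<close> is 0 ^ 0 = 1.\<close>
  have c0: "0 < c"
    using assms by (cases "n = 1") (auto simp: c_def intro!: zero_less_power)
  have c1: "c \<le> 1" using N0 assms by (auto simp: c_def intro!: power_le_one)
  have bernoulli: "1 - real (n - 1) / real N \<le> c"
    using Bernoulli_inequality[of "- 1 / real N" "n - 1"] assms by (simp add: c_def)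
  have half: "0 < 1 - real (n - 1) / real N"
    using assms N0 by (simp add: field_simps)
  have le: "rho (hyp_pmf N l n) (binomial_pmf n (real l / real N)) \<le> ereal (inverse c)"
    if "l \<le> N" for l
    using pmf_hyp_pmf_le[OF assms(1-3) that] c0 by (intro rho_le) (auto simp: c_def)
  have eq: "rho (hyp_pmf N 1 n) (binomial_pmf n (1 / real N)) = ereal (inverse c)"
  proof (rule antisym)
    show "rho (hyp_pmf N 1 n) (binomial_pmf n (1 / real N)) \<le> ereal (inverse c)"
      using le[of 1] assms by simp
    have h: "pmf (hyp_pmf N 1 n) 1 = real n / real N"
    proof -
      have "real n * real (N choose n) = real N * real ((N - 1) choose (n - 1))"
        using Suc_times_binomial_eq[of "N - 1" "n - 1"] assms
        unfolding of_nat_mult[symmetric] of_nat_eq_iff by (simp add: mult.commute)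
      moreover have "0 < real (N choose n)" using assms by simp
      ultimately have "real ((N - 1) choose (n - 1)) / real (N choose n) = real n / real N"
        using N0 by (simp add: field_simps)
      then show ?thesis
        using pmf_hyp_pmf[of n N 1 1] assms by simp
    qed
    have b: "pmf (binomial_pmf n (1 / real N)) 1 = real n / real N * c"
      using assms N0 by (simp add: c_def)
    \<comment> \<open>The event {1} attains the supremum: its probabilities are n / N and (n / N)
      c.\<close>
    have "ereal (inverse c) = ratio_conv (measure_pmf.prob (hyp_pmf N 1 n) {1})
        (measure_pmf.prob (binomial_pmf n (1 / real N)) {1})"
      unfolding measure_pmf_single h b using c0 N0 assms by (simp add: ratio_conv_def field_simps)
    then show "ereal (inverse c) \<le> rho (hyp_pmf N 1 n) (binomial_pmf n (1 / real N))"
      unfolding rho_def by (simp only:) (rule SUP_upper, simp)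
  qed
  let ?h = "hyp_pmf N L n" and ?b = "binomial_pmf n (real L / real N)"
  define e where "e = 1 - falling (real L) n / falling (real N) n
                - falling (real N - real L) n / falling (real N) n"
  \<comment> \<open>The prefactor in the total variation bound is the hypergeometric mass strictly
    between 0 and n; in particular it is nonnegative.\<close>
  have mid: "measure_pmf.prob ?h {0<..<n} = e"
  proof -
    have "1 = measure_pmf.prob ?h {..n}"
      using set_pmf_hyp_pmf[OF assms(2,4)] by (simp add: measure_pmf.prob_eq_1 AE_measure_pmf_iff subset_iff)
    also have "{..n} = insert 0 (insert n {0<..<n})" using assms(1) by auto
    also have "measure_pmf.prob ?h \<dots> = pmf ?h 0 + (pmf ?h n + measure_pmf.prob ?h {0<..<n})"
      using assms(1) by (simp add: measure_measure_pmf_finite)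
    finally show ?thesis unfolding e_def pmf_hyp_pmf_extreme[OF assms(2,4)] by simp
  qed
  have "dTV ?h ?b \<le> e * (1 - c)"
  proof (rule dTV_le)
    fix A
    have "measure_pmf.prob ?h A = measure_pmf.prob ?h (A \<inter> {..n})"
      using set_pmf_hyp_pmf[OF assms(2,4)] by (intro measure_pmf.finite_measure_eq_AE) (auto simp: AE_measure_pmf_iff)
    moreover have "measure_pmf.prob ?b (A \<inter> {..n}) \<le> measure_pmf.prob ?b A"
      by (intro measure_pmf.finite_measure_mono) auto
    ultimately have "measure_pmf.prob ?h A - measure_pmf.prob ?b A
        \<le> (\<Sum>k\<in>A \<inter> {..n}. pmf ?h k - pmf ?b k)"
      by (simp add: measure_measure_pmf_finite sum_subtractf)
    also have "\<dots> \<le> (\<Sum>k\<in>A \<inter> {..n}. if k \<in> {0<..<n} then pmf ?h k * (1 - c) else 0)"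
    proof (rule sum_mono)
      fix k assume "k \<in> A \<inter> {..n}"
      then show "pmf ?h k - pmf ?b k \<le> (if k \<in> {0<..<n} then pmf ?h k * (1 - c) else 0)"
        using pmf_hyp_pmf_le[OF assms, of k] pmf_hyp_pmf_extreme_le[OF assms(1,2,4), of k]
        by (auto simp: c_def algebra_simps)
    qed
    also have "\<dots> = (\<Sum>k\<in>A \<inter> {..n} \<inter> {0<..<n}. pmf ?h k * (1 - c))"
      by (simp add: sum.inter_restrict)
    also have "\<dots> \<le> (\<Sum>k\<in>{0<..<n}. pmf ?h k * (1 - c))"
      using c1 by (intro sum_mono2) auto
    also have "\<dots> = e * (1 - c)"
      unfolding mid[symmetric] by (simp add: measure_measure_pmf_finite sum_distrib_right)
    finally show "measure_pmf.prob ?h A - measure_pmf.prob ?b A \<le> e * (1 - c)" .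
  qed
  moreover have "e * (1 - c) \<le> e * (real (n - 1) / real N)"
    using bernoulli unfolding mid[symmetric] by (intro mult_left_mono) auto
  moreover have "inverse c \<le> inverse (1 - real (n - 1) / real N)"
    using bernoulli half by (intro le_imp_inverse_le)
  ultimately show ?thesis
    using le[OF assms(4)] eq unfolding c_def[symmetric] e_def[symmetric] by simp
qed

end
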